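(* Let $n$ be a positive integer with $n\equiv 2\pmod 3$. Then, modulo $\Phi_n(q)^3$, \[ \sum_{k=0}^{(2n-1)/3}\frac{(q;q^3)_k^3}{(q^3;q^3)_k^3}q^{3k} \equiv q^{(2n-1)/3}\frac{(q^2;q^3)_{(2n-1)/3}^2}{(q^3;q^3)_{(2n-1)/3}^2} \bigg\{1-[2n]^2\sum_{i=1}^{(2n-1)/3}\frac{q^{3i-1}}{[3i-1]^2}\bigg\}. \]
   Context: For a complex $x$ and $q$, $(x;q)_0=1$ and $(x;q)_m=(1-x)(1-xq)\cdots(1-xq^{m-1})$ for positive integers $m$. $[m]=(1-q^m)/(1-q)$ denotes the $q$-integer. $\Phi_n(q)$ is the $n$-th cyclotomic polynomial in $q$. For rational functions $A(q),B(q)$ whose denominators are coprime to $\Phi_n(q)$, $A\equiv B\pmod{\Phi_n(q)^3}$ means the numerator of $A-B$ (in lowest terms) is divisible by $\Phi_n(q)^3$ in $\mathbb{Z}[q]$. *)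

theory Defs
  imports Complex_Main "HOL-Computational_Algebra.Computational_Algebra"
begin

type_synonym ratfun = "int poly fract"

definition qvar :: ratfun where
  "qvar = Fract [:0, 1:] 1"

definition qpoch :: "ratfun \<Rightarrow> ratfun \<Rightarrow> nat \<Rightarrow> ratfun" where
  "qpoch x b m = (\<Prod>j<m. 1 - x * b ^ j)"

definition qint :: "nat \<Rightarrow> ratfun" where
  "qint m = (1 - qvar ^ m) / (1 - qvar)"

definition cyclotomic :: "nat \<Rightarrow> int poly" where
  "cyclotomic n = (THE p. map_poly of_int p =
      (\<Prod>k\<in>{k\<in>{1..n}. coprime k n}. [:- cis (2 * pi * real k / real n), 1:] :: complex poly))"

text \<open>A = B mod M: the numerator of A - B in lowest terms is divisible by M in Z[q].\<close>
definition qcong :: "ratfun \<Rightarrow> ratfun \<Rightarrow> int poly \<Rightarrow> bool" where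
  "qcong A B M \<longleftrightarrow> M dvd fst (quot_of_fract (A - B))"

end

theory Submission
  imports Defs
begin

text \<open>Write \<open>n = 3h + 2\<close>, \<open>N = (2n - 1)/3 = 2h + 1\<close>, \<open>p = q\<^sup>3\<close>, \<open>t = q\<^sup>n\<close>, \<open>z = q\<^sup>2\<^sup>n\<close>, \<open>w = 1/z\<close>, and let
  \<open>X\<^sub>k = (q;p)\<^sub>k\<^sup>2\<close>, \<open>Y\<^sub>k = (qz;p)\<^sub>k (qw;p)\<^sub>k\<close>. The left-hand side is \<open>\<Sum> X\<^sub>k e\<^sub>k\<close>. Perturbing one of the
  remaining factors gives coefficients \<open>e'\<^sub>k\<close> that are congruent to \<open>e\<^sub>k\<close> modulo \<open>\<Phi>\<^sub>n\<close> and for which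
  \<open>\<Sum> X\<^sub>k e'\<^sub>k\<close>, \<open>\<Sum> Y\<^sub>k e'\<^sub>k\<close> and also \<open>\<Sum> Y\<^sub>k e\<^sub>k\<close> are terminating balanced sums, hence products by
  the q-Pfaff--Saalschuetz formula. Since \<open>X\<^sub>k \<equiv> Y\<^sub>k\<close> modulo \<open>\<Phi>\<^sub>n\<^sup>2\<close>, the sum \<open>\<Sum> (X\<^sub>k - Y\<^sub>k)(e\<^sub>k - e'\<^sub>k)\<close> vanishes
  modulo \<open>\<Phi>\<^sub>n\<^sup>3\<close>, which expresses the left-hand side through these products. Their common factor
  \<open>(1 - t)\<^sup>2\<close> reduces the comparison with the right-hand side to a congruence modulo \<open>\<Phi>\<^sub>n\<close>, where
  both sides become \<open>-3 q\<^sup>N (q\<^sup>2;p)\<^sub>N\<^sup>2 / (p;p)\<^sub>N\<^sup>2\<close>.\<close>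

section \<open>Cyclotomic polynomials\<close>

abbreviation cpoly :: "int poly \<Rightarrow> complex poly" where
  "cpoly \<equiv> map_poly of_int"

lemma cpoly_mult: "cpoly (p * r) = cpoly p * cpoly r"
  by (rule poly_eqI) (simp add: coeff_map_poly coeff_mult)

lemma cpoly_dvd: "p dvd r \<Longrightarrow> cpoly p dvd cpoly r"
  by (auto simp: dvd_def cpoly_mult)

lemma cpoly_eq_iff: "cpoly p = cpoly r \<longleftrightarrow> p = r"
  by (auto simp: poly_eq_iff coeff_map_poly)

lemma cpoly_xn_minus_1: "cpoly (monom 1 m - 1) = monom 1 m - 1"
  by (rule poly_eqI) (simp add: coeff_map_poly)

lemma poly_xn_minus_1: "poly (monom 1 m - 1) z = z ^ m - (1 :: 'a :: comm_ring_1)"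
  by (simp add: poly_monom)

lemma xn_minus_1_dvd:
  assumes "d dvd n"
  shows "monom 1 d - 1 dvd (monom 1 n - 1 :: 'a :: comm_ring_1 poly)"
proof -
  obtain k where "n = d * k" using assms by blast
  then have "monom 1 n = (monom 1 d :: 'a poly) ^ k" by (simp add: monom_power)
  then show ?thesis
    by (simp add: power_diff_1_eq)
qed

lemma lead_coeff_xn_minus_1:
  assumes "n > 0"
  shows "lead_coeff (monom 1 n - 1 :: 'a :: comm_ring_1 poly) = 1"
proof -
  have "degree (monom 1 n + - 1 :: 'a poly) = degree (monom 1 n :: 'a poly)"
    using assms by (intro degree_add_eq_left) (simp add: degree_monom_eq)
  then show ?thesis using assms by (simp add: degree_monom_eq)
qed

lemma xn_minus_1_nonzero: "n > 0 \<Longrightarrow> monom 1 n - 1 \<noteq> (0 :: 'a :: comm_ring_1 poly)"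
  using lead_coeff_xn_minus_1[of n, where 'a = 'a] by (metis coeff_0 zero_neq_one)

text \<open>The derivative \<open>n X^(n-1)\<close> vanishes only at 0, which is not a root of
  \<open>X^n - 1\<close>.\<close>

lemma rsquarefree_xn_minus_1:
  assumes "n > 0"
  shows "rsquarefree (monom 1 n - 1 :: complex poly)"
  unfolding rsquarefree_roots
  using assms by (auto simp: poly_monom pderiv_diff pderiv_monom power_0_left)

lemma rsquarefree_dvd:
  assumes "rsquarefree r" "p dvd r"
  shows "rsquarefree p"
proof -
  have r: "r \<noteq> 0" using assms by (auto simp: rsquarefree_def)
  then have "p \<noteq> 0" using assms by auto
  moreover have "order a p \<le> order a r" for a
    using dvd_imp_order_le[OF r assms(2)] by auto
  ultimately show ?thesis using assms(1) unfolding rsquarefree_def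
    by (metis le_0_eq le_neq_implies_less less_one)
qed

text \<open>The angle \<open>2 pi k m / n\<close> must be an integral multiple of
  \<open>2 pi\<close>, so \<open>n\<close> divides \<open>m * k\<close>, and coprimality removes
  \<open>k\<close>.\<close>

lemma root_of_unity_coprime:
  assumes "n > 0" "coprime k n" "cis (2 * pi * real k / real n) ^ m = 1"
  shows "n dvd m"
proof -
  have "cis (real m * (2 * pi * real k / real n)) = 1"
    using assms(3) by (simp add: DeMoivre)
  then have "cos (real m * (2 * pi * real k / real n)) = 1" by (simp add: complex_eq_iff)
  then obtain j :: int where "real m * (2 * pi * real k / real n) = real_of_int j * 2 * pi"
    using cos_one_2pi_int by metis
  then have "real m * real k = real_of_int j * real n"
    using assms(1) by (simp add: field_simps)
  then have "real_of_int (int m * int k) = real_of_int (j * int n)" by simp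
  then have "int m * int k = j * int n" using of_int_eq_iff by blast
  then have "int n dvd int (m * k)" by simp
  then have "n dvd m * k" by presburger
  then show ?thesis using assms(2) by (metis coprime_commute coprime_dvd_mult_left_iff)
qed

text \<open>Dividing \<open>X\<^sup>n - 1\<close> by the integral least common multiple of the \<open>X\<^sup>d - 1\<close> removes exactly
  the non-primitive roots, so the quotient is integral without any induction over the divisors.\<close>

lemma cyclotomic_exists:
  assumes "n > 1"
  shows "\<exists>p :: int poly. cpoly p = (\<Prod>k\<in>{k\<in>{1..n}. coprime k n}. [:- cis (2 * pi * real k / real n), 1:])
           \<and> p dvd monom 1 n - 1"
proof -
  define D where "D = {d. d dvd n \<and> d < n}"
  have finD: "finite D" by (simp add: D_def)
  have D_pos: "d > 0" if "d \<in> D" for d using that assms by (auto simp: D_def intro: Nat.gr0I)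
  define F :: "int poly" where "F = monom 1 n - 1"
  define B :: "int poly" where "B = Lcm ((\<lambda>d. monom 1 d - 1) ` D)"
  have "B dvd F" unfolding B_def F_def
    by (rule Lcm_least) (auto simp: D_def intro!: xn_minus_1_dvd)
  then obtain Q where Q: "F = B * Q" by blast
  have lc: "lead_coeff B * lead_coeff Q = 1"
    using lead_coeff_xn_minus_1[of n, where 'a = int] assms
    by (simp add: Q[symmetric] F_def flip: lead_coeff_mult)
  \<comment> \<open>The leading coefficient of \<open>B\<close> is 1 or -1, because \<open>F\<close>
    is monic; moving this sign into \<open>Q\<close> makes the quotient \<open>P\<close>
    monic.\<close>
  define P where "P = smult (lead_coeff B) Q"
  have "B \<noteq> 0" using lc by (metis coeff_0 degree_0 mult_zero_left zero_neq_one)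
  then have lcP: "lead_coeff P = 1" using lc by (simp add: P_def)
  have sq: "lead_coeff B * lead_coeff B = 1"
    using lc by (metis zmult_eq_1_iff mult_minus1 minus_mult_minus mult_1)
  have FP: "F = smult (lead_coeff B) B * P" using Q sq by (simp add: P_def)
  have CF: "cpoly F = monom 1 n - 1" by (simp only: F_def cpoly_xn_minus_1)
  define C where "C = cpoly (smult (lead_coeff B) B)"
  have CFP: "monom 1 n - 1 = C * cpoly P" using FP CF by (metis C_def cpoly_mult)
  \<comment> \<open>The lcm divides the product of all \<open>X^d - 1\<close> with \<open>d\<close>
    in \<open>D\<close> and is a multiple of each of them, so over the complex numbers it has the
    union of their roots.\<close>
  have B_root: "poly C z = 0 \<longleftrightarrow> (\<exists>d\<in>D. z ^ d = 1)" for z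
  proof
    assume "poly C z = 0"
    moreover have "B dvd (\<Prod>d\<in>D. monom 1 d - 1)" unfolding B_def
      by (rule Lcm_least) (auto intro!: dvd_prodI finD)
    then obtain R where "(\<Prod>d\<in>D. monom 1 d - 1) = B * R" by blast
    then have "(\<Prod>d\<in>D. monom 1 d - 1) = smult (lead_coeff B) B * smult (lead_coeff B) R"
      using sq by simp
    then have "smult (lead_coeff B) B dvd (\<Prod>d\<in>D. monom 1 d - 1)" by (rule dvdI)
    then have "C dvd cpoly (\<Prod>d\<in>D. monom 1 d - 1)"
      unfolding C_def by (rule cpoly_dvd)
    moreover have "cpoly (\<Prod>d\<in>D. monom 1 d - 1) = (\<Prod>d\<in>D. monom 1 d - 1)"
      using finD by (induction D rule: finite_induct) (simp_all add: cpoly_mult cpoly_xn_minus_1)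
    ultimately have "poly (\<Prod>d\<in>D. monom 1 d - 1) z = 0"
      by (metis poly_eq_0_iff_dvd dvd_trans)
    then show "\<exists>d\<in>D. z ^ d = 1" by (auto simp: poly_prod finD poly_monom)
  next
    assume "\<exists>d\<in>D. z ^ d = 1"
    then obtain d where d: "d \<in> D" "z ^ d = 1" by blast
    have "monom 1 d - 1 dvd smult (lead_coeff B) B"
      unfolding B_def using d by (intro dvd_smult dvd_Lcm imageI)
    then have "cpoly (monom 1 d - 1) dvd C" unfolding C_def by (rule cpoly_dvd)
    moreover have "poly (cpoly (monom 1 d - 1)) z = 0"
      using d by (simp only: cpoly_xn_minus_1 poly_xn_minus_1 diff_self)
    ultimately show "poly C z = 0" by (metis poly_eq_0_iff_dvd dvd_trans)
  qed
  have sqf: "rsquarefree (C * cpoly P)" unfolding CFP[symmetric]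
    using assms by (intro rsquarefree_xn_minus_1) auto
  then have P_sqf: "rsquarefree (cpoly P)" by (rule rsquarefree_dvd) simp
  define K where "K = {k\<in>{1..n}. coprime k n}"
  define f where "f = (\<lambda>k. cis (2 * pi * real k / real n))"
  have bij: "bij_betw f {..<n} {z. z ^ n = 1}"
    unfolding f_def using assms by (intro bij_betw_roots_unity) auto
  have K_sub: "K \<subseteq> {..<n}"
  proof
    fix k assume "k \<in> K"
    then have "k \<le> n" "coprime k n" by (auto simp: K_def)
    moreover have "k \<noteq> n" using \<open>coprime k n\<close> assms by auto
    ultimately show "k \<in> {..<n}" by auto
  qed
  have roots: "{z. poly (cpoly P) z = 0} = f ` K"
  proof (intro equalityI subsetI)
    fix z assume "z \<in> {z. poly (cpoly P) z = 0}"
    then have z: "poly (cpoly P) z = 0" by simp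
    then have "poly (monom 1 n - 1) z = 0" by (simp add: CFP)
    then have "z ^ n = 1" by (simp add: poly_monom)
    then obtain k where k: "k < n" "z = f k"
      using bij by (auto simp: bij_betw_def)
    \<comment> \<open>A common root of the two factors would be a double root of
      \<open>X^n - 1\<close>.\<close>
    have "\<not> poly C z = 0"
    proof
      assume c: "poly C z = 0"
      then have "poly (pderiv (C * cpoly P)) z = 0" using z by (simp add: pderiv_mult)
      then show False using sqf z by (auto simp: rsquarefree_roots)
    qed
    then have nonroot: "\<not> (\<exists>d\<in>D. z ^ d = 1)" by (simp add: B_root)
    have "coprime k n"
    proof (rule ccontr)
      assume "\<not> coprime k n"
      \<comment> \<open>Cancelling \<open>g\<close> in \<open>k / n\<close> shows that
        \<open>z\<close> already has order dividing \<open>n div g\<close>, a proper divisor of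
        \<open>n\<close>.\<close>
      define g where "g = gcd k n"
      have g: "g \<noteq> 1" "g dvd n" "g dvd k" "g > 0"
        using \<open>\<not> coprime k n\<close> assms by (auto simp: g_def coprime_iff_gcd_eq_1)
      have "n div g < n" using g assms by (intro div_less_dividend) auto
      moreover have "n div g dvd n" using g by (metis dvd_div_mult_self dvd_triv_left)
      ultimately have "n div g \<in> D" by (simp add: D_def)
      moreover have "z ^ (n div g) = 1"
      proof -
        obtain k' where k': "k = g * k'" using g by blast
        have ng: "real (n div g) * real g = real n"
          using g by (metis dvd_div_mult_self of_nat_mult)
        have "real (n div g) * (2 * pi * real k / real n) = 2 * pi * real k'"
          using ng k' assms by (simp add: field_simps)
        then show ?thesis unfolding k f_def DeMoivre
          by (simp add: cis_multiple_2pi)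
      qed
      ultimately show False using nonroot by blast
    qed
    moreover have "k \<noteq> 0" using \<open>coprime k n\<close> assms by (intro notI) auto
    ultimately have "k \<in> K" using k by (auto simp: K_def)
    then show "z \<in> f ` K" using k by blast
  next
    fix z assume "z \<in> f ` K"
    then obtain k where k: "k \<in> K" "z = f k" by blast
    then have "k < n" using K_sub by auto
    then have "z ^ n = 1" using bij k by (auto simp: bij_betw_def)
    then have "poly (C * cpoly P) z = 0" by (simp add: CFP[symmetric] poly_monom)
    moreover have "\<not> (\<exists>d\<in>D. z ^ d = 1)"
    proof
      assume "\<exists>d\<in>D. z ^ d = 1"
      then obtain d where d: "d \<in> D" "z ^ d = 1" by blast
      have "n dvd d" using d k assms
        by (intro root_of_unity_coprime[of n k]) (auto simp: K_def f_def)
      then show False using d D_pos[of d] by (auto simp: D_def dest: dvd_imp_le)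
    qed
    ultimately show "z \<in> {z. poly (cpoly P) z = 0}" by (simp add: B_root)
  qed
  have lead: "lead_coeff (cpoly P) = 1"
    using lcP by (simp add: coeff_map_poly degree_map_poly)
  have "cpoly P = (\<Prod>z\<in>f ` K. [:- z, 1:])"
    using complex_poly_decompose_rsquarefree[OF P_sqf] by (simp only: lead roots smult_1_left)
  also have "\<dots> = (\<Prod>k\<in>K. [:- f k, 1:])"
    using bij_betw_imp_inj_on[OF bij] K_sub by (subst prod.reindex) (auto intro: inj_on_subset)
  finally have "cpoly P = (\<Prod>k\<in>K. [:- f k, 1:])" .
  moreover have "P dvd F" by (subst FP) (rule dvd_triv_right)
  ultimately show ?thesis unfolding K_def f_def F_def by blast
qed

text \<open>Existence is the preceding lemma; uniqueness, which resolves the definite description,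
  is the injectivity of \<open>cpoly\<close>.\<close>

lemma cyclotomic_spec:
  assumes "n > 1"
  shows "cpoly (cyclotomic n) = (\<Prod>k\<in>{k\<in>{1..n}. coprime k n}. [:- cis (2 * pi * real k / real n), 1:])"
    and "cyclotomic n dvd monom 1 n - 1"
proof -
  obtain p where p: "cpoly p = (\<Prod>k\<in>{k\<in>{1..n}. coprime k n}. [:- cis (2 * pi * real k / real n), 1:])"
    "p dvd monom 1 n - 1"
    using cyclotomic_exists[OF assms] by blast
  have "cyclotomic n = p" unfolding cyclotomic_def
    by (rule the_equality, fact p(1)) (metis p(1) cpoly_eq_iff)
  then show "cpoly (cyclotomic n) = (\<Prod>k\<in>{k\<in>{1..n}. coprime k n}. [:- cis (2 * pi * real k / real n), 1:])"
    and "cyclotomic n dvd monom 1 n - 1" using p by auto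
qed

text \<open>A constant divisor divides the leading coefficient, which is 1. This handles integer
  constants, which complex roots cannot detect.\<close>

lemma is_unit_if_degree_0_dvd_xn_minus_1:
  fixes d :: "int poly"
  assumes "d dvd monom 1 n - 1" "n > 0" "degree d = 0"
  shows "is_unit d"
proof -
  obtain c where c: "d = [:c:]" using assms(3) by (metis degree_eq_zeroE)
  obtain r where "monom 1 n - 1 = d * r" using assms(1) by blast
  then have "lead_coeff (monom 1 n - 1 :: int poly) = c * lead_coeff r"
    by (simp add: c)
  then have "c dvd 1" using lead_coeff_xn_minus_1[OF assms(2), where 'a = int] by (metis dvd_triv_left)
  then show ?thesis by (simp add: c is_unit_const_poly_iff)
qed

text \<open>A nonconstant common divisor would have a complex root that is both a primitive
  \<open>n\<close>-th and an \<open>m\<close>-th root of unity.\<close>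

lemma coprime_cyclotomic_xn_minus_1:
  assumes "n > 1" "\<not> n dvd m"
  shows "coprime (cyclotomic n) (monom 1 m - 1)"
proof (rule coprimeI)
  fix d assume d: "d dvd cyclotomic n" "d dvd monom 1 m - 1"
  have dn: "d dvd monom 1 n - 1" using d(1) cyclotomic_spec(2)[OF assms(1)] by (rule dvd_trans)
  have "degree d = 0"
  proof (rule ccontr)
    assume "degree d \<noteq> 0"
    then have "degree (cpoly d) \<noteq> 0" by (simp add: degree_map_poly)
    then obtain z where z: "poly (cpoly d) z = 0"
      using fundamental_theorem_of_algebra[of "cpoly d"] by (auto simp: constant_degree)
    have "poly (cpoly (cyclotomic n)) z = 0" "poly (cpoly (monom 1 m - 1)) z = 0"
      using z cpoly_dvd[OF d(1)] cpoly_dvd[OF d(2)] by (metis poly_eq_0_iff_dvd dvd_trans)+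
    then obtain k where "coprime k n" "z = cis (2 * pi * real k / real n)" "z ^ m = 1"
      unfolding cyclotomic_spec(1)[OF assms(1)] cpoly_xn_minus_1
      by (auto simp: poly_prod poly_monom)
    then show False using root_of_unity_coprime[of n k m] assms by auto
  qed
  then show "is_unit d" using dn assms(1) by (intro is_unit_if_degree_0_dvd_xn_minus_1[of d n]) auto
qed

text \<open>A common divisor divides both \<open>X^n - 1\<close> and \<open>X^n\<close>, hence
  1.\<close>

lemma coprime_cyclotomic_X:
  assumes "n > 1"
  shows "coprime (cyclotomic n) [:0, 1:]"
proof (rule coprimeI)
  fix d assume d: "d dvd cyclotomic n" "d dvd [:0, 1:]"
  have "d dvd monom 1 n - 1" using d(1) cyclotomic_spec(2)[OF assms] by (rule dvd_trans)
  moreover have "d dvd monom 1 n"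
    using dvd_trans[OF d(2), of "monom 1 n"] assms
    by (metis dvd_power dvd_trans less_imp_triv monom_altdef mult.left_neutral smult_1_left
        zero_less_one order_less_trans)
  ultimately show "is_unit d" by (metis diff_diff_eq2 dvd_diff add_diff_cancel_left' diff_add_cancel)
qed

section \<open>Congruences in a localization\<close>

locale localization =
  fixes M :: "int poly"
  assumes not_unit: "\<not> is_unit M"
begin

definition integral :: "ratfun set" where
  "integral = {Fract u v | u v. coprime M v}"

definition invertible :: "ratfun \<Rightarrow> bool" where
  "invertible A \<longleftrightarrow> (\<exists>u v. coprime M u \<and> coprime M v \<and> A = Fract u v)"

text \<open>Divisibility of \<open>A - B\<close> by the \<open>r\<close>-th power of
  \<open>M\<close> inside the localization \<open>integral\<close>. Arithmetic is done with this
  relation, and lowest terms enter only in \<open>lcong_imp_qcong\<close>.\<close>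

definition lcong :: "nat \<Rightarrow> ratfun \<Rightarrow> ratfun \<Rightarrow> bool" where
  "lcong r A B \<longleftrightarrow> (\<exists>C\<in>integral. A - B = Fract M 1 ^ r * C)"

text \<open>Being coprime to 0 means being a unit, which \<open>M\<close> is not.\<close>

lemma coprime_nonzero: "coprime M v \<Longrightarrow> v \<noteq> 0"
  using not_unit by auto

lemma integral_of_poly: "Fract u 1 \<in> integral"
  unfolding integral_def by (intro CollectI exI[of _ u] exI[of _ 1]) simp

lemma integral_0 [simp]: "0 \<in> integral"
  using integral_of_poly[of 0] by (simp add: Zero_fract_def)

lemma integral_1 [simp]: "1 \<in> integral"
  using integral_of_poly[of 1] by (simp add: One_fract_def)

lemma integral_add [intro]: "A \<in> integral \<Longrightarrow> B \<in> integral \<Longrightarrow> A + B \<in> integral"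
  unfolding integral_def by (force simp: coprime_nonzero)

lemma integral_mult [intro]: "A \<in> integral \<Longrightarrow> B \<in> integral \<Longrightarrow> A * B \<in> integral"
  unfolding integral_def by force

lemma integral_minus [intro]: "A \<in> integral \<Longrightarrow> - A \<in> integral"
  unfolding integral_def by force

lemma integral_diff [intro]: "A \<in> integral \<Longrightarrow> B \<in> integral \<Longrightarrow> A - B \<in> integral"
  using integral_add[of A "- B"] by auto

lemma integral_power [intro]: "A \<in> integral \<Longrightarrow> A ^ k \<in> integral"
  by (induction k) auto

lemma integral_prod [intro]: "(\<And>i. i \<in> I \<Longrightarrow> f i \<in> integral) \<Longrightarrow> prod f I \<in> integral"
  by (induction I rule: infinite_finite_induct) auto

lemma integral_of_nat [simp]: "of_nat k \<in> integral"
  by (induction k) auto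

lemma integral_numeral [simp]: "numeral k \<in> integral"
  using integral_of_nat[of "numeral k"] by simp

lemma invertible_1 [simp]: "invertible 1"
  unfolding invertible_def by (rule exI[of _ 1], rule exI[of _ 1]) (simp add: One_fract_def)

lemma invertible_integral: "invertible A \<Longrightarrow> A \<in> integral"
  unfolding invertible_def integral_def by blast

lemma invertible_nonzero: "invertible A \<Longrightarrow> A \<noteq> 0"
  unfolding invertible_def by (auto simp: coprime_nonzero eq_fract Zero_fract_def)

lemma invertible_inverse: "invertible A \<Longrightarrow> invertible (inverse A)"
  unfolding invertible_def by (metis inverse_fract)

lemma invertible_mult: "invertible A \<Longrightarrow> invertible B \<Longrightarrow> invertible (A * B)"
  unfolding invertible_def by (metis coprime_mult_right_iff mult_fract)

lemma invertible_minus: "invertible A \<Longrightarrow> invertible (- A)"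
  unfolding invertible_def by (metis coprime_minus_right_iff minus_fract)

lemma invertible_power: "invertible A \<Longrightarrow> invertible (A ^ k)"
  by (induction k) (auto intro: invertible_mult)

lemma invertible_prod: "(\<And>i. i \<in> I \<Longrightarrow> invertible (f i)) \<Longrightarrow> invertible (prod f I)"
  by (induction I rule: infinite_finite_induct) (auto intro: invertible_mult)

lemma integral_divide: "A \<in> integral \<Longrightarrow> invertible B \<Longrightarrow> A / B \<in> integral"
  unfolding divide_inverse by (blast intro: invertible_inverse invertible_integral)

lemma lcong_refl [simp]: "lcong r A A"
  unfolding lcong_def by (rule bexI[of _ 0]) auto

lemma lcong_sym: "lcong r A B \<Longrightarrow> lcong r B A"
  unfolding lcong_def by (metis integral_minus minus_diff_eq mult_minus_right)

lemma lcong_trans [trans]: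
  assumes "lcong r A B" "lcong r B C"
  shows "lcong r A C"
proof -
  obtain X Y where "X \<in> integral" "A - B = Fract M 1 ^ r * X" "Y \<in> integral" "B - C = Fract M 1 ^ r * Y"
    using assms by (auto simp: lcong_def)
  moreover from this have "A - C = Fract M 1 ^ r * (X + Y)" by (simp add: algebra_simps)
  ultimately show ?thesis unfolding lcong_def by blast
qed

lemma lcong_add:
  assumes "lcong r A A'" "lcong r B B'"
  shows "lcong r (A + B) (A' + B')"
proof -
  obtain X Y where "X \<in> integral" "A - A' = Fract M 1 ^ r * X" "Y \<in> integral" "B - B' = Fract M 1 ^ r * Y"
    using assms by (auto simp: lcong_def)
  moreover from this have "(A + B) - (A' + B') = Fract M 1 ^ r * (X + Y)" by (simp add: algebra_simps)
  ultimately show ?thesis unfolding lcong_def by blast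
qed

lemma lcong_minus: "lcong r A A' \<Longrightarrow> lcong r (- A) (- A')"
  unfolding lcong_def by (metis integral_minus minus_diff_minus mult_minus_right)

lemma lcong_diff: "lcong r A A' \<Longrightarrow> lcong r B B' \<Longrightarrow> lcong r (A - B) (A' - B')"
  using lcong_add[OF _ lcong_minus, of r A A' B B'] by simp

lemma lcong_iff_diff: "lcong r A B \<longleftrightarrow> lcong r (A - B) 0"
  by (simp add: lcong_def)

lemma lcong_sum:
  "(\<And>i. i \<in> I \<Longrightarrow> lcong r (f i) (g i)) \<Longrightarrow> lcong r (sum f I) (sum g I)"
  by (induction I rule: infinite_finite_induct) (auto intro: lcong_add)

text \<open>Exponents add: this is how congruences modulo the square and modulo the first power
  combine into one modulo the cube.\<close>

lemma lcong_0_mult: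
  assumes "lcong r A 0" "lcong s B 0"
  shows "lcong (r + s) (A * B) 0"
proof -
  obtain X Y where "X \<in> integral" "A = Fract M 1 ^ r * X" "Y \<in> integral" "B = Fract M 1 ^ s * Y"
    using assms by (auto simp: lcong_def)
  moreover from this have "A * B = Fract M 1 ^ (r + s) * (X * Y)" by (simp add: power_add mult_ac)
  ultimately show ?thesis unfolding lcong_def by (metis diff_zero integral_mult)
qed

text \<open>With exponent 0 the relation only expresses integrality, so \<open>lcong_0_mult\<close>
  also covers multiplication by integral elements.\<close>

lemma lcong_modulus_0: "A \<in> integral \<Longrightarrow> lcong 0 A 0"
  by (simp add: lcong_def)

lemma lcong_mult_left: 
  assumes "C \<in> integral" "lcong r A B"
  shows "lcong r (C * A) (C * B)"
  using lcong_0_mult[OF lcong_modulus_0[OF assms(1)] assms(2)[unfolded lcong_iff_diff[of r A]]]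
  by (subst lcong_iff_diff) (simp add: algebra_simps)

lemma lcong_mult_right: "C \<in> integral \<Longrightarrow> lcong r A B \<Longrightarrow> lcong r (A * C) (B * C)"
  using lcong_mult_left[of C r A B] by (simp add: mult.commute)

lemma lcong_integral: "lcong r A B \<Longrightarrow> B \<in> integral \<Longrightarrow> A \<in> integral"
  unfolding lcong_def
  by (metis diff_add_cancel integral_add integral_mult integral_of_poly integral_power)

lemma lcong_mult:
  assumes "lcong r A A'" "lcong r B B'" "A' \<in> integral" "B' \<in> integral"
  shows "lcong r (A * B) (A' * B')"
  using lcong_mult_right[OF lcong_integral[OF assms(2,4)] assms(1)] lcong_mult_left[OF assms(3,2)]
  by (rule lcong_trans)

lemma lcong_power:
  assumes "lcong r A A'" "A' \<in> integral"
  shows "lcong r (A ^ k) (A' ^ k)"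
  by (induction k) (auto intro: lcong_mult assms)

lemma lcong_prod:
  "(\<And>i. i \<in> I \<Longrightarrow> lcong r (f i) (g i)) \<Longrightarrow> (\<And>i. i \<in> I \<Longrightarrow> g i \<in> integral) \<Longrightarrow> lcong r (prod f I) (prod g I)"
  by (induction I rule: infinite_finite_induct) (auto intro: lcong_mult)

text \<open>Over the common denominator \<open>b * v\<close>, the numerator of \<open>A\<close>
  differs from \<open>a * v\<close> by a multiple of \<open>M\<close>, so it stays coprime to
  \<open>M\<close>.\<close>

lemma lcong_invertible:
  assumes "lcong 1 A B" "invertible B"
  shows "invertible A"
proof -
  obtain a b where ab: "coprime M a" "coprime M b" "B = Fract a b"
    using assms by (auto simp: invertible_def)
  obtain u v where uv: "coprime M v" "A - B = Fract M 1 * Fract u v"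
    using assms by (auto simp: lcong_def integral_def)
  have "A = Fract a b + Fract M 1 * Fract u v" using uv ab by (simp add: algebra_simps)
  also have "\<dots> = Fract (a * v + M * u * b) (b * v)"
    using ab uv by (simp add: coprime_nonzero)
  finally have A: "A = Fract (a * v + M * u * b) (b * v)" .
  have "coprime M (a * v)" using ab uv by simp
  then have "coprime M (a * v + M * u * b)"
    unfolding coprime_def by (metis dvd_add_left_iff dvd_mult2)
  then show ?thesis using A ab uv unfolding invertible_def
    by (metis coprime_mult_right_iff)
qed

text \<open>The difference of the inverses is \<open>- (A - B) / (A * B)\<close>.\<close>

lemma lcong_inverse:
  assumes "lcong r A B" "invertible A" "invertible B"
  shows "lcong r (inverse A) (inverse B)"
proof -
  have "inverse A - inverse B = (- inverse A * inverse B) * (A - B)"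
    using assms(2,3)[THEN invertible_nonzero] by (simp add: field_simps)
  moreover have "- inverse A * inverse B \<in> integral"
    using assms by (intro integral_mult integral_minus invertible_integral invertible_inverse)
  ultimately show ?thesis using assms(1) lcong_mult_left[of "- inverse A * inverse B" r "A - B" 0]
    by (metis lcong_iff_diff mult_zero_right)
qed

lemma lcong_divide:
  assumes "lcong r A A'" "lcong r B B'" "A' \<in> integral" "invertible B" "invertible B'"
  shows "lcong r (A / B) (A' / B')"
  unfolding divide_inverse
  by (intro lcong_mult lcong_inverse assms invertible_integral[OF invertible_inverse])

text \<open>Cross-multiplying with the lowest-terms form shows that \<open>M ^ r\<close> divides the
  numerator times \<open>v\<close>, and \<open>v\<close> is coprime to \<open>M\<close>.\<close>

lemma lcong_imp_qcong:
  assumes "lcong r A B"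
  shows "qcong A B (M ^ r)"
proof -
  obtain u v where uv: "coprime M v" "A - B = Fract M 1 ^ r * Fract u v"
    using assms by (auto simp: lcong_def integral_def)
  have pow: "Fract M 1 ^ r = Fract (M ^ r) 1" by (induction r) (simp_all add: One_fract_def)
  define x where "x = quot_of_fract (A - B)"
  have "Fract (fst x) (snd x) = Fract (M ^ r * u) v" unfolding x_def using uv pow by simp
  moreover have "snd x \<noteq> 0" by (simp add: x_def)
  ultimately have "fst x * v = M ^ r * (u * snd x)"
    using uv by (simp add: eq_fract coprime_nonzero algebra_simps)
  then have "M ^ r dvd fst x * v" by simp
  moreover have "coprime (M ^ r) v" using uv by simp
  ultimately have "M ^ r dvd fst x" by (simp add: coprime_dvd_mult_left_iff)
  then show ?thesis by (simp add: qcong_def x_def)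
qed

end

section \<open>The q-Pfaff-Saalschuetz summation\<close>

lemma qpoch_0 [simp]: "qpoch x b 0 = 1"
  by (simp add: qpoch_def)

lemma qpoch_Suc: "qpoch x b (Suc m) = qpoch x b m * (1 - x * b ^ m)"
  by (simp add: qpoch_def)

lemma qpoch_Suc_left: "qpoch x b (Suc m) = (1 - x) * qpoch (x * b) b m"
  unfolding qpoch_def prod.lessThan_Suc_shift by (simp add: mult.assoc)

lemma qpoch_add: "qpoch x b (k + m) = qpoch x b k * qpoch (x * b ^ k) b m"
  by (induction m) (simp_all add: qpoch_Suc power_add mult.assoc)

text \<open>The Gaussian binomial coefficient in base \<open>p\<close>, given by a Pascal rule
  instead of a quotient so that no factor has to be nonzero.\<close>

fun qbinom :: "ratfun \<Rightarrow> nat \<Rightarrow> nat \<Rightarrow> ratfun" where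
  "qbinom p n 0 = 1"
| "qbinom p 0 (Suc k) = 0"
| "qbinom p (Suc n) (Suc k) = qbinom p n (Suc k) + p ^ (Suc n - Suc k) * qbinom p n k"

lemma qbinom_eq_0: "n < k \<Longrightarrow> qbinom p n k = 0"
  by (induction p n k rule: qbinom.induct) auto

lemma qbinom_self [simp]: "qbinom p n n = 1"
  by (induction n) (simp_all add: qbinom_eq_0)

text \<open>With \<open>n = m + k + 1\<close>, the two Pascal terms combine by
  \<open>(1 - p^(m+1)) + p^(m+1) (1 - p^(k+1)) = 1 - p^(n+1)\<close>.\<close>

lemma qbinom_mult_qpoch:
  "k \<le> n \<Longrightarrow> qbinom p n k * (qpoch p p k * qpoch p p (n - k)) = qpoch p p n"
proof (induction p n k rule: qbinom.induct)
  case (3 p n k)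
  show ?case
  proof (cases "k = n")
    case False
    then have k: "Suc k \<le> n" using 3 by auto
    define m where "m = n - Suc k"
    have nk: "n = m + Suc k" using k by (simp add: m_def)
    have IH1: "qbinom p n (Suc k) * (qpoch p p (Suc k) * qpoch p p m) = qpoch p p n"
      using 3(1) k by (simp add: m_def)
    have IH2: "qbinom p n k * (qpoch p p k * qpoch p p (Suc m)) = qpoch p p n"
      using 3(2) k by (simp add: m_def Suc_diff_Suc)
    have "qbinom p (Suc n) (Suc k) * (qpoch p p (Suc k) * qpoch p p (Suc m)) =
       qbinom p n (Suc k) * (qpoch p p (Suc k) * qpoch p p m) * (1 - p * p ^ m)
       + p ^ Suc m * (qbinom p n k * (qpoch p p k * qpoch p p (Suc m))) * (1 - p * p ^ k)"
      by (simp add: nk qpoch_Suc algebra_simps)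
    also have "\<dots> = qpoch p p n * (1 - p * p ^ n)"
      unfolding IH1 IH2 by (simp add: nk power_add algebra_simps)
    finally show ?thesis by (simp add: nk qpoch_Suc)
  qed (simp add: qbinom_eq_0 qpoch_Suc)
qed auto

text \<open>The dual Pascal rule, with the power of \<open>p\<close> on the other term. The
  coefficient recurrence in \<open>q_saalschuetz_polynomial\<close> uses both rules.\<close>

lemma qbinom_Suc_Suc': "qbinom p (Suc n) (Suc k) = p ^ Suc k * qbinom p n (Suc k) + qbinom p n k"
proof (induction n arbitrary: k)
  case (Suc n)
  show ?case
  proof (cases "k \<le> n")
    case True
    then obtain m where m: "n = m + k" by (metis le_add_diff_inverse2)
    show ?thesis
    proof (cases k)
      case 0
      have "p * qbinom p (Suc n) (Suc 0) = p * (p * qbinom p n (Suc 0) + 1)"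
        using Suc[of 0] by simp
      then show ?thesis using 0 Suc[of 0] by (simp add: algebra_simps)
    next
      case (Suc j)
      have "qbinom p (Suc (Suc n)) (Suc k) = qbinom p (Suc n) (Suc k) + p ^ Suc m * qbinom p (Suc n) k"
        by (simp add: m Suc_diff_le)
      also have "\<dots> = p ^ Suc k * qbinom p n (Suc k) + qbinom p n k
          + p ^ Suc m * (p ^ k * qbinom p n k + qbinom p n j)"
        using Suc.IH[of k] Suc.IH[of j] Suc by simp
      also have "\<dots> = p ^ Suc k * (qbinom p n (Suc k) + p ^ m * qbinom p n k)
          + (qbinom p n k + p ^ Suc m * qbinom p n j)"
        by (simp add: power_add algebra_simps)
      also have "\<dots> = p ^ Suc k * qbinom p (Suc n) (Suc k) + qbinom p (Suc n) k"
        using Suc by (simp add: m Suc_diff_le)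
      finally show ?thesis .
    qed
  next
    case False
    then show ?thesis by (cases "k = Suc n") (simp_all add: qbinom_eq_0)
  qed
qed (cases k; simp)

text \<open>The case \<open>c = y * A * B\<close> of the q-Pfaff--Saalschuetz sum, with denominators cleared. The product
  \<open>(1 - yAp\<^sup>N) (1 - yBp\<^sup>N)\<close> is a linear combination of \<open>1\<close> and \<open>(1 - Ap\<^sup>k) (1 - Bp\<^sup>k)\<close>, which gives
  a Pascal-type recurrence for the coefficients.\<close>

lemma q_saalschuetz_polynomial:
  "qpoch (y * A) p N * qpoch (y * B) p N =
     (\<Sum>k\<le>N. qbinom p N k * qpoch (y * A * B * p ^ k) p (N - k) * qpoch y p (N - k) * y ^ k
              * (qpoch A p k * qpoch B p k))"
proof (induction N)
  case (Suc N)
  define c where "c = y * A * B"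
  define C where "C = (\<lambda>N k. qbinom p N k * qpoch (c * p ^ k) p (N - k) * qpoch y p (N - k) * y ^ k)"
  define Q where "Q = (\<lambda>k. qpoch A p k * qpoch B p k)"
  define \<alpha> where "\<alpha> = (\<lambda>k. (1 - y * p ^ (N - k)) * (1 - c * p ^ (N + k)))"
  define \<beta> where "\<beta> = (\<lambda>k. y * p ^ (N - k))"
  \<comment> \<open>Multiplying by the two new factors splits each term into one at \<open>k\<close>
    and one at \<open>k + 1\<close>.\<close>
  have split: "(1 - y * A * p ^ N) * (1 - y * B * p ^ N) * Q k = \<alpha> k * Q k + \<beta> k * Q (Suc k)"
    if "k \<le> N" for k
  proof -
    define m where "m = N - k"
    have N: "N = m + k" using that by (simp add: m_def)
    have "(1 - y * A * (P * K)) * (1 - y * B * (P * K)) =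
      (1 - y * P) * (1 - y * A * B * (P * K * K)) + y * P * ((1 - A * K) * (1 - B * K))" for P K
      by (simp add: algebra_simps)
    from this[of "p ^ m" "p ^ k"]
    have *: "(1 - y * A * p ^ N) * (1 - y * B * p ^ N) = \<alpha> k + \<beta> k * ((1 - A * p ^ k) * (1 - B * p ^ k))"
      by (simp add: N \<alpha>_def \<beta>_def c_def power_add mult.assoc)
    show ?thesis unfolding * by (simp add: Q_def qpoch_Suc distrib_right distrib_left mult_ac)
  qed
  have rec: "C (Suc N) (Suc k) = \<alpha> (Suc k) * C N (Suc k) + \<beta> k * C N k" if "k \<le> N" for k
  proof (cases "k = N")
    case True
    then show ?thesis by (simp add: C_def \<beta>_def qbinom_eq_0)
  next
    case False
    define m where "m = N - Suc k"
    have m: "N = m + Suc k" using False that by (simp add: m_def)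
    define X where "X = qpoch (c * p ^ Suc k) p m * qpoch y p (Suc m) * y ^ Suc k"
    have 1: "C (Suc N) (Suc k) = qbinom p (Suc N) (Suc k) * (1 - c * p ^ N) * X"
    proof -
      have "c * p ^ Suc k * p ^ m = c * p ^ N" by (simp add: m power_add mult_ac)
      then show ?thesis by (simp add: C_def X_def m qpoch_Suc mult_ac del: power_Suc qbinom.simps)
    qed
    have 2: "\<alpha> (Suc k) * C N (Suc k) = qbinom p N (Suc k) * (1 - c * p ^ (N + Suc k)) * X"
    proof -
      have "N - Suc k = m" by (simp add: m)
      then show ?thesis by (simp add: C_def X_def \<alpha>_def qpoch_Suc mult_ac del: power_Suc qbinom.simps)
    qed
    have 3: "\<beta> k * C N k = p ^ Suc m * qbinom p N k * (1 - c * p ^ k) * X"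
    proof -
      have "N - k = Suc m" "c * p ^ k * p = c * p ^ Suc k" by (simp_all add: m mult_ac)
      then have "C N k = qbinom p N k * ((1 - c * p ^ k) * qpoch (c * p ^ Suc k) p m) * qpoch y p (Suc m) * y ^ k"
        by (simp only: C_def qpoch_Suc_left)
      moreover have "\<beta> k = y * p ^ Suc m" using \<open>N - k = Suc m\<close> by (simp only: \<beta>_def)
      ultimately show ?thesis by (simp add: X_def mult_ac)
    qed
    have "qbinom p (Suc N) (Suc k) * (1 - c * p ^ N) =
        qbinom p (Suc N) (Suc k) - c * p ^ N * qbinom p (Suc N) (Suc k)"
      by (simp only: algebra_simps)
    \<comment> \<open>The first binomial is expanded by the defining Pascal rule, the one multiplied
      by \<open>c * p ^ N\<close> by the dual rule.\<close>
    also have "\<dots> = qbinom p N (Suc k) + p ^ Suc m * qbinom p N k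
        - c * p ^ N * (p ^ Suc k * qbinom p N (Suc k) + qbinom p N k)"
      by (subst (2) qbinom_Suc_Suc') (simp add: m)
    also have "\<dots> = qbinom p N (Suc k) * (1 - c * p ^ (N + Suc k)) + p ^ Suc m * qbinom p N k * (1 - c * p ^ k)"
      by (simp only: m power_add power_Suc algebra_simps)
    finally have e: "qbinom p (Suc N) (Suc k) * (1 - c * p ^ N) =
        qbinom p N (Suc k) * (1 - c * p ^ (N + Suc k)) + p ^ Suc m * qbinom p N k * (1 - c * p ^ k)" .
    show ?thesis unfolding 1 2 3 e by (rule distrib_right)
  qed
  have rec0: "C (Suc N) 0 = \<alpha> 0 * C N 0"
    by (simp add: C_def \<alpha>_def qpoch_Suc mult_ac)
  have top: "C N (Suc N) = 0" by (simp add: C_def qbinom_eq_0)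
  have "qpoch (y * A) p (Suc N) * qpoch (y * B) p (Suc N) =
      (1 - y * A * p ^ N) * (1 - y * B * p ^ N) * (\<Sum>k\<le>N. C N k * Q k)"
    using Suc by (simp add: qpoch_Suc C_def Q_def c_def mult_ac)
  also have "\<dots> = (\<Sum>k\<le>N. C N k * ((1 - y * A * p ^ N) * (1 - y * B * p ^ N) * Q k))"
    by (simp add: sum_distrib_left mult_ac)
  also have "\<dots> = (\<Sum>k\<le>N. \<alpha> k * C N k * Q k) + (\<Sum>k\<le>N. \<beta> k * C N k * Q (Suc k))"
    unfolding sum.distrib [symmetric]
    by (intro sum.cong refl, subst split) (simp_all add: distrib_left mult_ac)
  \<comment> \<open>Adding the vanishing term at \<open>N + 1\<close> allows an index shift that
    aligns both sums.\<close>
  also have "(\<Sum>k\<le>N. \<alpha> k * C N k * Q k) = (\<Sum>k\<le>Suc N. \<alpha> k * C N k * Q k)"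
    by (simp add: top)
  also have "\<dots> = \<alpha> 0 * C N 0 * Q 0 + (\<Sum>k\<le>N. \<alpha> (Suc k) * C N (Suc k) * Q (Suc k))"
    by (rule sum.atMost_Suc_shift)
  also have "\<dots> + (\<Sum>k\<le>N. \<beta> k * C N k * Q (Suc k)) = C (Suc N) 0 * Q 0 + (\<Sum>k\<le>N. C (Suc N) (Suc k) * Q (Suc k))"
    by (simp add: rec rec0 sum.distrib distrib_right add.assoc)
  also have "\<dots> = (\<Sum>k\<le>Suc N. C (Suc N) k * Q k)"
    by (rule sum.atMost_Suc_shift [symmetric])
  finally show ?case by (simp add: C_def Q_def c_def)
qed simp

lemma qpoch_nonzero_mono:
  assumes "qpoch x b m \<noteq> 0" "k \<le> m"
  shows "qpoch x b k \<noteq> 0"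
  using assms qpoch_add[of x b k "m - k"] by auto

text \<open>The hypothesis pairs factor \<open>j\<close> on the left with factor
  \<open>k - 1 - j\<close> on the right:
  \<open>1 - x p^j = - x p^j (1 - x' p^(k-1-j))\<close>.\<close>

lemma qpoch_reverse:
  assumes "p \<noteq> 0" "x * x' * p ^ k = p"
  shows "qpoch x p k = (- x) ^ k * (\<Prod>j<k. p ^ j) * qpoch x' p k"
proof -
  have "qpoch x' p k = (\<Prod>j<k. 1 - x' * p ^ (k - Suc j))"
    unfolding qpoch_def by (rule prod.nat_diff_reindex [symmetric])
  then have "(- x) ^ k * (\<Prod>j<k. p ^ j) * qpoch x' p k = (\<Prod>j<k. - x * p ^ j * (1 - x' * p ^ (k - Suc j)))"
    by (simp only: prod.distrib prod_constant card_lessThan)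
  also have "\<dots> = qpoch x p k"
    unfolding qpoch_def
  proof (rule prod.cong [OF refl])
    fix j assume "j \<in> {..<k}"
    then have "p ^ k = p * (p ^ j * p ^ (k - Suc j))"
      by (simp flip: power_add power_Suc)
    then have "p * (x * x' * (p ^ j * p ^ (k - Suc j))) = p * 1"
      using assms(2) by (simp add: mult_ac)
    then have "x * x' * (p ^ j * p ^ (k - Suc j)) = 1"
      using assms(1) by (simp only: mult_cancel_left) simp
    then show "- x * p ^ j * (1 - x' * p ^ (k - Suc j)) = 1 - x * p ^ j"
      by (simp add: algebra_simps)
  qed
  finally show ?thesis by simp
qed

text \<open>Here \<open>u\<close> is \<open>p^(-N)\<close>, which terminates the series. The result
  is the polynomial identity at \<open>y = c / (A B)\<close>, divided by
  \<open>(c;p)_N (y;p)_N\<close>; reversing products produces the parameters \<open>u\<close> and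
  \<open>d\<close>.\<close>

lemma q_saalschuetz:
  assumes nz: "p \<noteq> 0" "A \<noteq> 0" "B \<noteq> 0" "c \<noteq> 0"
    and u: "u * p ^ N = 1" and balanced: "c * d = A * B * p * u"
    and pN: "qpoch p p N \<noteq> 0" and cN: "qpoch c p N \<noteq> 0" and dN: "qpoch d p N \<noteq> 0"
  shows "(\<Sum>k\<le>N. qpoch A p k * qpoch B p k * qpoch u p k * p ^ k / (qpoch p p k * qpoch c p k * qpoch d p k))
    = qpoch (c / A) p N * qpoch (c / B) p N / (qpoch c p N * qpoch (c / (A * B)) p N)"
proof -
  define y where "y = c / (A * B)"
  have y0: "y \<noteq> 0" using nz by (simp add: y_def)
  have yd: "y * d = p * u" using balanced nz by (simp add: y_def field_simps)
  have ydN: "y * d * p ^ N = p" using u by (simp add: yd)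
  have yN: "qpoch y p N \<noteq> 0"
    using y0 nz dN by (subst qpoch_reverse[OF nz(1) ydN]) simp
  have "qpoch A p k * qpoch B p k * qpoch u p k * p ^ k / (qpoch p p k * qpoch c p k * qpoch d p k)
      * (qpoch c p N * qpoch y p N)
    = qbinom p N k * qpoch (y * A * B * p ^ k) p (N - k) * qpoch y p (N - k) * y ^ k
        * (qpoch A p k * qpoch B p k)" if k: "k \<le> N" for k
  proof -
    have pow: "p ^ (N - k) * p ^ k = p ^ N" using k by (simp flip: power_add)
    have "y * p ^ (N - k) * d * p ^ k = y * d * p ^ N" by (simp add: mult_ac flip: pow)
    then have 1: "qpoch (y * p ^ (N - k)) p k = (- (y * p ^ (N - k))) ^ k * (\<Prod>j<k. p ^ j) * qpoch d p k"
      using ydN by (intro qpoch_reverse nz) simp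
    have "p * p ^ (N - k) * u * p ^ k = p * (u * p ^ N)" by (simp add: mult_ac flip: pow)
    then have 2: "qpoch (p * p ^ (N - k)) p k = (- (p * p ^ (N - k))) ^ k * (\<Prod>j<k. p ^ j) * qpoch u p k"
      using u by (intro qpoch_reverse nz) simp
    \<comment> \<open>The prefactors of the two reversals differ only by the ratio
      \<open>(y / p)^k\<close>.\<close>
    have 3: "qpoch (y * p ^ (N - k)) p k * qpoch u p k * p ^ k = y ^ k * qpoch (p * p ^ (N - k)) p k * qpoch d p k"
      unfolding 1 2 power_minus[of "y * p ^ (N - k)"] power_minus[of "p * p ^ (N - k)"] power_mult_distrib by simp
    have split: "qpoch x p N = qpoch x p (N - k) * qpoch (x * p ^ (N - k)) p k" for x
      using qpoch_add[of x p "N - k" k] k by simp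
    have splitc: "qpoch c p N = qpoch c p k * qpoch (c * p ^ k) p (N - k)"
      using qpoch_add[of c p k "N - k"] k by simp
    have c: "y * A * B = c" using nz by (simp add: y_def)
    have ne: "qpoch p p k \<noteq> 0" "qpoch p p (N - k) \<noteq> 0" "qpoch c p k \<noteq> 0" "qpoch d p k \<noteq> 0"
      using pN cN dN k by (metis qpoch_nonzero_mono diff_le_self)+
    have bin: "qbinom p N k = qpoch (p * p ^ (N - k)) p k / qpoch p p k"
      using qbinom_mult_qpoch[OF k, of p] ne split[of p] by (simp add: field_simps)
    show ?thesis unfolding c bin splitc split[of y] using ne 3 
      by (simp add: divide_simps) (simp add: mult_ac)
  qed
  then have "(\<Sum>k\<le>N. qpoch A p k * qpoch B p k * qpoch u p k * p ^ k / (qpoch p p k * qpoch c p k * qpoch d p k))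
      * (qpoch c p N * qpoch y p N) = qpoch (y * A) p N * qpoch (y * B) p N"
    unfolding q_saalschuetz_polynomial sum_distrib_right by (intro sum.cong) auto
  moreover have "y * A = c / B" "y * B = c / A" using nz by (simp_all add: y_def)
  ultimately show ?thesis using cN yN by (simp add: y_def field_simps)
qed

section \<open>The congruence\<close>

lemma qvar_power: "qvar ^ m = Fract (monom 1 m) 1"
proof (induction m)
  case 0
  then show ?case by (simp add: One_fract_def)
next
  case (Suc m)
  then show ?case by (simp add: qvar_def monom_Suc)
qed

lemma qvar_power_minus_1: "qvar ^ m - 1 = Fract (monom 1 m - 1) 1"
  by (simp add: qvar_power One_fract_def)

lemma qvar_power_neq_1: "m > 0 \<Longrightarrow> qvar ^ m \<noteq> 1"
  using xn_minus_1_nonzero[of m, where 'a = int] qvar_power_minus_1[of m]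
  by (auto simp: Zero_fract_def eq_fract)

lemma qvar_nonzero: "qvar \<noteq> 0"
  by (simp add: qvar_def Zero_fract_def eq_fract)

text \<open>The primitive root of unity with \<open>k = 1\<close> is a root, whereas a unit has
  none.\<close>

lemma not_unit_cyclotomic:
  assumes "n > 1"
  shows "\<not> is_unit (cyclotomic n)"
proof
  assume "is_unit (cyclotomic n)"
  then have "cpoly (cyclotomic n) dvd cpoly 1" by (rule cpoly_dvd)
  then have "cpoly (cyclotomic n) dvd 1" by simp
  moreover have "poly (cpoly (cyclotomic n)) (cis (2 * pi * real 1 / real n)) = 0"
    unfolding cyclotomic_spec(1)[OF assms] poly_prod
    using assms by (intro prod_zero) (auto intro!: bexI[of _ 1])
  ultimately show False by (metis poly_eq_0_iff_dvd dvd_trans poly_1 zero_neq_one)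
qed

section \<open>Units and congruences modulo the cyclotomic polynomial\<close>

locale two_mod_three =
  fixes h n N :: nat and p z w t :: ratfun
  defines "n \<equiv> 3 * h + 2" and "N \<equiv> 2 * h + 1"
    and "p \<equiv> qvar ^ 3" and "z \<equiv> qvar ^ (2 * n)" and "w \<equiv> inverse (qvar ^ (2 * n))" and "t \<equiv> qvar ^ n"
begin

sublocale localization "cyclotomic n"
  by unfold_locales (rule not_unit_cyclotomic, simp add: n_def)

lemma n_gt_1: "n > 1"
  by (simp add: n_def)

lemma t_cong_1: "lcong 1 t 1"
proof -
  obtain r where "monom 1 n - 1 = cyclotomic n * r" using cyclotomic_spec(2)[OF n_gt_1] by blast
  then have "t - 1 = Fract (cyclotomic n) 1 ^ 1 * Fract r 1"
    by (simp add: t_def qvar_power_minus_1)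
  then show ?thesis unfolding lcong_def using integral_of_poly by blast
qed

lemma t_minus_1_squared: "lcong 2 ((1 - t) ^ 2) 0"
proof -
  have "lcong 1 (1 - t) 0" using lcong_diff[OF lcong_refl t_cong_1, of 1] by simp
  from lcong_0_mult[OF this this] show ?thesis by (simp add: power2_eq_square numeral_2_eq_2)
qed

text \<open>The factor \<open>(1 - t) ^ 2\<close> supplies two of the three powers of the
  modulus.\<close>

lemma lcong_3I: "lcong 1 A B \<Longrightarrow> lcong 3 ((1 - t) ^ 2 * A) ((1 - t) ^ 2 * B)"
  using lcong_0_mult[OF t_minus_1_squared, of 1 "A - B"] lcong_iff_diff[of 1 A B]
  by (subst lcong_iff_diff) (simp add: right_diff_distrib del: One_nat_def)

lemma invertible_qvar: "invertible qvar"
  unfolding invertible_def qvar_def using coprime_cyclotomic_X[OF n_gt_1]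
  by (intro exI[of _ "[:0, 1:]"] exI[of _ 1]) simp

lemma invertible_1_minus:
  assumes "\<not> n dvd m"
  shows "invertible (1 - qvar ^ m)"
proof -
  have "invertible (qvar ^ m - 1)"
    unfolding invertible_def qvar_power_minus_1
    using coprime_cyclotomic_xn_minus_1[OF n_gt_1 assms]
    by (intro exI[of _ "monom 1 m - 1"] exI[of _ 1]) simp
  from invertible_minus[OF this] show ?thesis by simp
qed

lemma invertible_qvar_power: "invertible (qvar ^ m)"
  by (intro invertible_power invertible_qvar)

lemma integral_qvar_power [simp]: "qvar ^ m \<in> integral"
  by (intro invertible_integral invertible_qvar_power)

lemma integral_qvar [simp]: "qvar \<in> integral"
  using integral_qvar_power[of 1] by simp

lemma invertible_w: "invertible w"
  unfolding w_def by (intro invertible_inverse invertible_qvar_power)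

lemma integral_pzwt [simp]: "p \<in> integral" "z \<in> integral" "w \<in> integral" "t \<in> integral"
  using invertible_integral[OF invertible_w] by (simp_all add: p_def z_def t_def)

lemma z_eq: "z = t ^ 2"
  by (simp add: z_def t_def mult.commute flip: power_mult)

lemma zw: "z * w = 1"
  by (simp add: z_def w_def qvar_nonzero)

lemma z_cong_1: "lcong 1 z 1"
  using lcong_power[OF t_cong_1, of 2] by (simp add: z_eq)

lemma w_cong_1: "lcong 1 w 1"
proof -
  have "invertible z" unfolding z_def by (rule invertible_qvar_power)
  then show ?thesis using lcong_inverse[OF z_cong_1] by (simp add: w_def flip: z_def)
qed

lemma integral_qpoch [intro]: "x \<in> integral \<Longrightarrow> qpoch x p k \<in> integral"
  unfolding qpoch_def by (intro integral_prod integral_diff integral_mult integral_power) simp_all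

lemma lcong_qpoch:
  assumes "lcong r x y" "y \<in> integral"
  shows "lcong r (qpoch x p k) (qpoch y p k)"
  unfolding qpoch_def
  using assms
  by (intro lcong_prod lcong_diff lcong_mult_right integral_diff integral_mult integral_power) auto

lemma dvd_below_double:
  assumes "n dvd m" "0 < m" "m < 2 * n"
  shows "m = n"
proof -
  obtain c where c: "m = n * c" using assms by blast
  then have "c \<noteq> 0" "c < 2" using assms by auto
  then show ?thesis using c by (cases c) auto
qed

text \<open>The exponents \<open>3 (j + 1)\<close> are at most \<open>3 N = 2 n - 1\<close>, so the
  only multiple of \<open>n\<close> they could equal is \<open>n\<close> itself, which is not
  divisible by 3.\<close>

lemma invertible_qpoch_p:
  assumes "k \<le> N"
  shows "invertible (qpoch p p k)"
  unfolding qpoch_def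
proof (rule invertible_prod)
  fix j assume j: "j \<in> {..<k}"
  have "\<not> n dvd 3 * Suc j"
  proof
    assume "n dvd 3 * Suc j"
    then have "3 * Suc j = n"
      using j assms by (intro dvd_below_double) (auto simp: n_def N_def)
    then show False unfolding n_def by presburger
  qed
  from invertible_1_minus[OF this] show "invertible (1 - p * p ^ j)"
    by (simp only: p_def power_mult power_Suc)
qed

text \<open>The exponents \<open>3 j + 1\<close> lie below \<open>2 n\<close> and differ from
  \<open>n\<close>, which is 2 modulo 3.\<close>

lemma invertible_qpoch_q:
  assumes "k \<le> N"
  shows "invertible (qpoch qvar p k)"
  unfolding qpoch_def
proof (rule invertible_prod)
  fix j assume j: "j \<in> {..<k}"
  have "\<not> n dvd Suc (3 * j)"
  proof
    assume "n dvd Suc (3 * j)"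
    then have "Suc (3 * j) = n"
      using j assms by (intro dvd_below_double) (auto simp: n_def N_def)
    then show False unfolding n_def by presburger
  qed
  from invertible_1_minus[OF this] show "invertible (1 - qvar * p ^ j)"
    by (simp add: p_def power_mult)
qed

section \<open>Reversed products and powers of q\<close>

lemma p_power_N: "p ^ N * qvar = z"
proof -
  have "p ^ N * qvar = qvar ^ (3 * N + 1)" by (simp add: p_def power_mult)
  also have "3 * N + 1 = 2 * n" by (simp add: N_def n_def)
  finally show ?thesis by (simp add: z_def)
qed

text \<open>Since \<open>N - 1 = 2 h\<close>, the total exponent is
  \<open>3 h N + 2 N = n N\<close>.\<close>

lemma E_eq: "(\<Prod>j<N. p ^ j) * qvar ^ (2 * N) = t ^ N"
proof -
  have "(\<Sum>j<m. j) * 2 = m * (m - 1)" for m :: nat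
    by (induction m) (auto simp: algebra_simps)
  from this[of N] have "(\<Sum>j<N. j) = h * N" by (simp add: N_def)
  moreover have "(\<Prod>j<N. p ^ j) = p ^ (\<Sum>j<N. j)" by (rule power_sum [symmetric])
  ultimately have "(\<Prod>j<N. p ^ j) * qvar ^ (2 * N) = qvar ^ (3 * (h * N) + 2 * N)"
    by (simp only: p_def power_add flip: power_mult)
  also have "3 * (h * N) + 2 * N = n * N" by (simp add: n_def algebra_simps)
  finally show ?thesis by (simp add: t_def flip: power_mult)
qed

lemma p_nonzero: "p \<noteq> 0"
  by (simp add: p_def qvar_nonzero)

lemma qpoch_qw: "qpoch (qvar * w) p N = (- (qvar * w)) ^ N * (\<Prod>j<N. p ^ j) * qpoch p p N"
proof (rule qpoch_reverse[OF p_nonzero])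
  have "qvar * w * p * p ^ N = p * (p ^ N * qvar) * w" by (simp add: mult_ac)
  then show "qvar * w * p * p ^ N = p" by (simp add: p_power_N zw mult.assoc)
qed

lemma qpoch_q2w: "qpoch (qvar ^ 2 * w) p N = (- (qvar ^ 2 * w)) ^ N * (\<Prod>j<N. p ^ j) * qpoch (qvar ^ 2) p N"
proof (rule qpoch_reverse[OF p_nonzero])
  have "qvar ^ 2 * w * qvar ^ 2 * p ^ N = qvar ^ 3 * (p ^ N * qvar) * w"
    by (simp add: mult_ac power2_eq_square power3_eq_cube)
  then show "qvar ^ 2 * w * qvar ^ 2 * p ^ N = p" 
    unfolding p_power_N by (simp add: zw mult.assoc p_def)
qed

text \<open>Modulo the first power, \<open>qvar\<close> may be replaced by \<open>qvar * w\<close>.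
  Reversal then gives \<open>(p;p)_N\<close> times \<open>(-1)^N t^N w^N\<close>, which is congruent
  to -1 because \<open>N\<close> is odd.\<close>

lemma qpoch_q_cong: "lcong 1 (qvar ^ N * qpoch qvar p N) (- qpoch p p N)"
proof -
  have "lcong 1 (qpoch (qvar * w) p N) (qpoch (qvar * 1) p N)"
    by (intro lcong_qpoch lcong_mult_left w_cong_1) simp_all
  then have "lcong 1 (qvar ^ N * qpoch qvar p N) (qvar ^ N * qpoch (qvar * w) p N)"
    by (intro lcong_mult_left lcong_sym[of 1 _ "qpoch qvar p N"]) simp_all
  also have "qvar ^ N * qpoch (qvar * w) p N
     = (-1) ^ N * (((\<Prod>j<N. p ^ j) * qvar ^ (2 * N)) * w ^ N * qpoch p p N)"
    unfolding qpoch_qw power_minus[of "qvar * w"] power_mult_distrib mult_2 power_add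
    by (simp only: mult_ac)
  also have "\<dots> = - (t ^ N * w ^ N * qpoch p p N)"
    unfolding E_eq by (simp add: N_def)
  also have "lcong 1 \<dots> (- (1 ^ N * 1 ^ N * qpoch p p N))"
    by (intro lcong_minus lcong_mult lcong_power t_cong_1 w_cong_1 lcong_refl integral_qpoch integral_mult)
       simp_all
  finally show ?thesis by simp
qed

lemma sum_cong:
  "lcong 3 (\<Sum>k\<le>N. qpoch qvar p k ^ 3 / qpoch p p k ^ 3 * p ^ k)
     (qvar ^ N * qpoch (qvar ^ 2) p N ^ 2 / qpoch p p N ^ 2
      + (qpoch (qvar ^ 2) p N ^ 2 - qpoch (qvar ^ 2 * w) p N * qpoch (qvar ^ 2 * z) p N)
          / (qpoch p p N * qpoch qvar p N))"
proof -
  \<comment> \<open>In \<open>e'\<close> one upper parameter \<open>q\<close> becomes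
    \<open>q w\<close> and one lower parameter \<open>p\<close> becomes \<open>p w\<close>. Shifting
    both keeps the sums balanced.\<close>
  define e where "e = (\<lambda>k. qpoch qvar p k * p ^ k / (qpoch p p k * qpoch p p k * qpoch p p k))"
  define e' where "e' = (\<lambda>k. qpoch (qvar * w) p k * p ^ k / (qpoch p p k * qpoch p p k * qpoch (p * w) p k))"
  define X where "X = (\<lambda>k. qpoch qvar p k * qpoch qvar p k)"
  define Y where "Y = (\<lambda>k. qpoch (qvar * z) p k * qpoch (qvar * w) p k)"
  have nz: "p \<noteq> 0" "qvar \<noteq> 0" "z \<noteq> 0" "w \<noteq> 0"
    using p_nonzero qvar_nonzero zw by auto
  \<comment> \<open>So \<open>qvar * w\<close> is \<open>p^(-N)\<close>, the terminating parameter
    of the three sums evaluated below.\<close>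
  have u: "qvar * w * p ^ N = 1"
    using p_power_N zw by (metis mult.assoc mult.commute)
  have pN: "qpoch p p N \<noteq> 0" by (intro invertible_nonzero invertible_qpoch_p) simp
  have pw_cong: "lcong 1 (qpoch (p * w) p k) (qpoch p p k)" for k
    using lcong_qpoch[OF lcong_mult_left[OF _ w_cong_1, of p], of k] by simp
  have pw_inv: "invertible (qpoch (p * w) p k)" if "k \<le> N" for k
    using pw_cong invertible_qpoch_p[OF that] by (rule lcong_invertible)
  have pwN: "qpoch (p * w) p N \<noteq> 0" by (intro invertible_nonzero pw_inv) simp
  have p3: "p = qvar * qvar * qvar" by (simp add: p_def power3_eq_cube)
  have quot: "p / (qvar * z) = qvar ^ 2 * w" "p / qvar = qvar ^ 2" "p / (qvar * w) = qvar ^ 2 * z"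
    "p / (qvar * qvar) = qvar" "p / (qvar * (qvar * z)) = qvar * w" "p / (qvar * (qvar * (w * z))) = qvar"
    using nz zw by (simp_all add: p3 power2_eq_square divide_eq_eq mult_ac)
  have S1: "(\<Sum>k\<le>N. Y k * e k) = qpoch (qvar ^ 2 * w) p N * qpoch (qvar ^ 2) p N / (qpoch p p N * qpoch (qvar * w) p N)"
  proof -
    have "p * p = qvar * z * qvar * p * (qvar * w)"
      using zw by (simp add: p3 mult_ac)
    from q_saalschuetz[OF nz(1) _ nz(2) nz(1) u this pN pN pN]
    show ?thesis using nz by (simp add: quot Y_def e_def mult_ac)
  qed
  have S2: "(\<Sum>k\<le>N. X k * e' k) = qpoch (qvar ^ 2) p N * qpoch (qvar ^ 2) p N / (qpoch p p N * qpoch qvar p N)"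
  proof -
    have "p * (p * w) = qvar * qvar * p * (qvar * w)"
      by (simp add: p3 mult_ac)
    from q_saalschuetz[OF nz(1,2,2,1) u this pN pN pwN]
    show ?thesis by (simp add: quot X_def e'_def mult_ac)
  qed
  have S3: "(\<Sum>k\<le>N. Y k * e' k) = qpoch (qvar ^ 2 * w) p N * qpoch (qvar ^ 2 * z) p N / (qpoch p p N * qpoch qvar p N)"
  proof -
    have "p * (p * w) = qvar * z * (qvar * w) * p * (qvar * w)"
      using zw by (simp add: p3 mult_ac)
    from q_saalschuetz[OF nz(1) _ _ nz(1) u this pN pN pwN]
    show ?thesis using nz by (simp add: quot Y_def e'_def mult_ac)
  qed
  \<comment> \<open>After reversal of the products with parameters \<open>q^2 w\<close> and
    \<open>q w\<close>, their prefactors differ only by \<open>qvar ^ N\<close>.\<close>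
  have S1': "(\<Sum>k\<le>N. Y k * e k) = qvar ^ N * qpoch (qvar ^ 2) p N ^ 2 / qpoch p p N ^ 2"
  proof -
    have ne: "(- (qvar * w)) ^ N * (\<Prod>j<N. p ^ j) \<noteq> 0" using nz by simp
    have "(- (qvar ^ 2 * w)) ^ N = qvar ^ N * (- (qvar * w)) ^ N"
      by (simp add: power2_eq_square mult.assoc flip: power_mult_distrib)
    then have "qpoch (qvar ^ 2 * w) p N / qpoch (qvar * w) p N
      = ((- (qvar * w)) ^ N * (\<Prod>j<N. p ^ j)) * (qvar ^ N * qpoch (qvar ^ 2) p N)
        / (((- (qvar * w)) ^ N * (\<Prod>j<N. p ^ j)) * qpoch p p N)"
      unfolding qpoch_q2w qpoch_qw by (simp only: mult_ac)
    also have "\<dots> = qvar ^ N * qpoch (qvar ^ 2) p N / qpoch p p N"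
      using ne by (rule mult_divide_mult_cancel_left)
    finally have quotient: "qpoch (qvar ^ 2 * w) p N / qpoch (qvar * w) p N = \<dots>" .
    have swap: "a * b / (c * d) = a / d * b / c" for a b c d :: ratfun by simp
    show ?thesis unfolding S1 by (subst swap, subst quotient) (simp add: power2_eq_square mult_ac)
  qed
  have e_cong: "lcong 1 (e k) (e' k)" if "k \<le> N" for k
    unfolding e_def e'_def
  proof (intro lcong_divide lcong_mult_left lcong_mult_right lcong_sym[OF pw_cong] integral_mult
      integral_qpoch integral_power invertible_mult invertible_qpoch_p[OF that] pw_inv[OF that] integral_pzwt)
    show "lcong 1 (qpoch qvar p k) (qpoch (qvar * w) p k)"
      using lcong_qpoch[OF lcong_mult_left[OF _ w_cong_1, of qvar], of k] by (simp add: lcong_sym)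
  qed simp_all
  have XY_cong: "lcong 2 (X k) (Y k)" for k
    unfolding X_def Y_def qpoch_def prod.distrib [symmetric]
  proof (intro lcong_prod)
    fix j
    define x where "x = qvar * p ^ j"
    have x: "x \<in> integral" by (simp add: x_def integral_mult integral_power)
    \<comment> \<open>Because \<open>z w = 1\<close>, the difference of the factors is
      \<open>x w (1 - z)^2\<close>, and \<open>1 - z = (1 - t) (1 + t)\<close>.\<close>
    have "(1 - x) * (1 - x) - (1 - x * z) * (1 - x * w) = x * w * (1 - z) ^ 2 + (z * w - 1) * (2 * x - x ^ 2 - x * z)"
      by (simp add: power2_eq_square algebra_simps)
    also have "\<dots> = (x * w * (1 + t) ^ 2) * (1 - t) ^ 2"
      unfolding zw unfolding z_eq by (simp add: power2_eq_square algebra_simps)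
    finally have *: "(1 - x) * (1 - x) - (1 - x * z) * (1 - x * w) = \<dots>" .
    have "x * w * (1 + t) ^ 2 \<in> integral" using x by (intro integral_mult integral_power integral_add) simp_all
    then have "lcong 2 ((1 - x) * (1 - x) - (1 - x * z) * (1 - x * w)) 0"
      unfolding * using lcong_mult_left[OF _ t_minus_1_squared] by fastforce
    then have "lcong 2 ((1 - x) * (1 - x)) ((1 - x * z) * (1 - x * w))"
      by (subst lcong_iff_diff)
    then show "lcong 2 ((1 - qvar * p ^ j) * (1 - qvar * p ^ j)) ((1 - qvar * z * p ^ j) * (1 - qvar * w * p ^ j))"
      by (simp add: x_def mult_ac)
  qed (intro integral_mult integral_diff integral_power, simp_all)
  have "lcong 3 (\<Sum>k\<le>N. (X k - Y k) * (e k - e' k)) (\<Sum>k\<le>N. 0)"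
  proof (rule lcong_sum)
    fix k assume "k \<in> {..N}"
    then have "lcong (2 + 1) ((X k - Y k) * (e k - e' k)) 0"
      using XY_cong[of k] e_cong[of k] by (intro lcong_0_mult) (simp_all only: lcong_iff_diff[symmetric] atMost_iff)
    then show "lcong 3 ((X k - Y k) * (e k - e' k)) 0" by (simp del: One_nat_def)
  qed
  also have "(\<Sum>k\<le>N. (X k - Y k) * (e k - e' k))
      = (\<Sum>k\<le>N. X k * e k) - ((\<Sum>k\<le>N. Y k * e k) + ((\<Sum>k\<le>N. X k * e' k) - (\<Sum>k\<le>N. Y k * e' k)))"
    by (simp add: sum_subtractf sum.distrib algebra_simps)
  finally have main: "lcong 3 (\<Sum>k\<le>N. X k * e k)
      ((\<Sum>k\<le>N. Y k * e k) + ((\<Sum>k\<le>N. X k * e' k) - (\<Sum>k\<le>N. Y k * e' k)))"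
    by (subst lcong_iff_diff) simp
  have "(\<Sum>k\<le>N. X k * e k) = (\<Sum>k\<le>N. qpoch qvar p k ^ 3 / qpoch p p k ^ 3 * p ^ k)"
    by (simp add: X_def e_def power3_eq_cube mult_ac)
  with main show ?thesis unfolding S1' S2 S3
    by (simp add: power2_eq_square diff_divide_distrib)
qed

text \<open>The factor with index \<open>h\<close> is the only one in \<open>qpoch (qvar ^ 2) p N\<close> that vanishes modulo the
  cyclotomic polynomial.\<close>

definition cofactor :: "ratfun \<Rightarrow> ratfun" where
  "cofactor x = (\<Prod>j\<in>{..<N} - {h}. 1 - x * p ^ j)"

lemma qpoch_cofactor: "qpoch x p N = (1 - x * p ^ h) * cofactor x"
  unfolding qpoch_def cofactor_def by (rule prod.remove) (simp_all add: N_def)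

lemma integral_cofactor: "x \<in> integral \<Longrightarrow> cofactor x \<in> integral"
  unfolding cofactor_def by (intro integral_prod integral_diff integral_mult integral_power) simp_all

lemma lcong_cofactor:
  assumes "lcong r x y" "y \<in> integral"
  shows "lcong r (cofactor x) (cofactor y)"
  unfolding cofactor_def
  using assms
  by (intro lcong_prod lcong_diff lcong_mult_right integral_diff integral_mult integral_power) auto

lemma q2_p_h: "qvar ^ 2 * p ^ h = t"
proof -
  have "qvar ^ 2 * p ^ h = qvar ^ (2 + 3 * h)" by (simp only: p_def power_add power_mult)
  then show ?thesis by (simp add: t_def n_def add.commute)
qed

text \<open>The factors with index \<open>h\<close> are \<open>1 - t\<close>, \<open>1 - t w\<close>
  and \<open>1 - t z\<close>. As \<open>t w = 1/t\<close> and \<open>t z = t^3\<close>, the product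
  of the last two also contains \<open>(1 - t) ^ 2\<close>.\<close>

lemma qpoch_difference:
  "qpoch (qvar ^ 2) p N ^ 2 - qpoch (qvar ^ 2 * w) p N * qpoch (qvar ^ 2 * z) p N
    = (1 - t) ^ 2 * (cofactor (qvar ^ 2) ^ 2
        + t * w * (1 + t + t ^ 2) * (cofactor (qvar ^ 2 * w) * cofactor (qvar ^ 2 * z)))"
proof -
  have tw: "t * t * w = 1" using zw by (simp add: z_eq power2_eq_square)
  have "(1 - t * w) * (1 - t * z) = - ((1 - t) ^ 2 * (t * w * (1 + t + t ^ 2))) + (t * t * w - 1) * (t ^ 3 - 1)"
    by (simp add: z_eq power2_eq_square power3_eq_cube algebra_simps)
  then have *: "(1 - t * w) * (1 - t * z) = - ((1 - t) ^ 2 * (t * w * (1 + t + t ^ 2)))"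
    by (simp add: tw)
  have f: "qvar ^ 2 * w * p ^ h = t * w" "qvar ^ 2 * z * p ^ h = t * z"
    by (simp_all add: mult_ac flip: q2_p_h)
  have eq: "qpoch (qvar ^ 2) p N ^ 2 - qpoch (qvar ^ 2 * w) p N * qpoch (qvar ^ 2 * z) p N
    = (1 - t) ^ 2 * cofactor (qvar ^ 2) ^ 2 
      - ((1 - t * w) * (1 - t * z)) * (cofactor (qvar ^ 2 * w) * cofactor (qvar ^ 2 * z))"
    unfolding qpoch_cofactor f q2_p_h by (simp add: power_mult_distrib mult_ac)
  show ?thesis unfolding eq * by (simp add: distrib_left [of "(1 - t) ^ 2"] mult.assoc)
qed

text \<open>Only the summand \<open>i = h + 1\<close>, where \<open>3 i - 1 = n\<close>, has a
  denominator divisible by the modulus. It contributes \<open>t (1 + t)^2\<close>, congruent to 4;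
  all others are congruent to 0.\<close>

lemma rhs_factor_cong:
  "lcong 1 (1 - qint (2 * n) ^ 2 * (\<Sum>i=1..N. qvar ^ (3 * i - 1) / qint (3 * i - 1) ^ 2)) (- 3)"
proof -
  define f where "f = (\<lambda>i. (1 - z) ^ 2 * (qvar ^ (3 * i - 1) / (1 - qvar ^ (3 * i - 1)) ^ 2))"
  have "qvar \<noteq> 1" using qvar_power_neq_1[of 1] by simp
  then have "qint (2 * n) ^ 2 * (qvar ^ m / qint m ^ 2) = (1 - z) ^ 2 * (qvar ^ m / (1 - qvar ^ m) ^ 2)" for m
    by (simp add: qint_def z_def power_divide)
  then have "qint (2 * n) ^ 2 * (\<Sum>i=1..N. qvar ^ (3 * i - 1) / qint (3 * i - 1) ^ 2) = (\<Sum>i=1..N. f i)"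
    unfolding sum_distrib_left f_def by simp
  also have "\<dots> = f (Suc h) + (\<Sum>i\<in>{1..N} - {Suc h}. f i)"
    by (rule sum.remove) (simp_all add: N_def)
  also have "f (Suc h) = t * (1 + t) ^ 2"
  proof -
    have "1 - t \<noteq> 0" using qvar_power_neq_1[of n] n_gt_1 by (simp add: t_def)
    moreover have "1 - z = (1 - t) * (1 + t)" by (simp add: z_eq power2_eq_square algebra_simps)
    moreover have "3 * Suc h - 1 = n" by (simp add: n_def)
    ultimately show ?thesis by (simp add: f_def power_mult_distrib flip: t_def)
  qed
  finally have eq: "qint (2 * n) ^ 2 * (\<Sum>i=1..N. qvar ^ (3 * i - 1) / qint (3 * i - 1) ^ 2)
      = t * (1 + t) ^ 2 + (\<Sum>i\<in>{1..N} - {Suc h}. f i)" .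
  have "lcong 1 (f i) 0" if i: "i \<in> {1..N} - {Suc h}" for i
  proof -
    have "\<not> n dvd 3 * i - 1"
    proof
      assume "n dvd 3 * i - 1"
      then have "3 * i - 1 = n"
        using i by (intro dvd_below_double) (auto simp: n_def N_def)
      then show False using i by (auto simp: n_def)
    qed
    then have "qvar ^ (3 * i - 1) / (1 - qvar ^ (3 * i - 1)) ^ 2 \<in> integral"
      by (intro integral_divide integral_qvar_power invertible_power invertible_1_minus)
    moreover have "lcong 1 ((1 - z) ^ 2) ((1 - 1) ^ 2)"
      by (intro lcong_power lcong_diff lcong_refl z_cong_1) simp
    ultimately have "lcong 1 (f i) ((1 - 1) ^ 2 * (qvar ^ (3 * i - 1) / (1 - qvar ^ (3 * i - 1)) ^ 2))"
      unfolding f_def by (intro lcong_mult_right)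
    then show ?thesis by simp
  qed
  then have "lcong 1 (\<Sum>i\<in>{1..N} - {Suc h}. f i) (\<Sum>i\<in>{1..N} - {Suc h}. 0)" by (rule lcong_sum)
  then have "lcong 1 (1 - (t * (1 + t) ^ 2 + (\<Sum>i\<in>{1..N} - {Suc h}. f i))) (1 - (1 * (1 + 1) ^ 2 + 0))"
    by (intro lcong_diff lcong_add lcong_mult lcong_power lcong_refl t_cong_1 integral_power integral_add)
       simp_all
  then show ?thesis unfolding eq by simp
qed

lemma main_cong:
  "lcong 3 (\<Sum>k\<le>N. qpoch qvar p k ^ 3 / qpoch p p k ^ 3 * p ^ k)
    (qvar ^ N * qpoch (qvar ^ 2) p N ^ 2 / qpoch p p N ^ 2 *
      (1 - qint (2 * n) ^ 2 * (\<Sum>i=1..N. qvar ^ (3 * i - 1) / qint (3 * i - 1) ^ 2)))"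
    (is "lcong 3 ?S (_ * ?B)")
proof -
  define C where "C = cofactor (qvar ^ 2)"
  define K where "K = C ^ 2 + t * w * (1 + t + t ^ 2) * (cofactor (qvar ^ 2 * w) * cofactor (qvar ^ 2 * z))"
  define P where "P = qpoch p p N"
  \<comment> \<open>Up to the factor \<open>(1 - t) ^ 2\<close>, \<open>a\<close> is the leading
    product of both sides and \<open>b\<close> the correction term of \<open>sum_cong\<close>. The
    goal reduces to \<open>a + b\<close> being congruent to \<open>- 3 a\<close>.\<close>
  define a where "a = qvar ^ N * C ^ 2 / P ^ 2"
  define b where "b = K / (P * qpoch qvar p N)"
  have C_int: "C \<in> integral" unfolding C_def by (intro integral_cofactor) simp
  have P_inv: "invertible P" unfolding P_def by (rule invertible_qpoch_p) simp
  have a_int: "a \<in> integral" unfolding a_def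
    by (intro integral_divide integral_mult integral_power invertible_power C_int P_inv) simp
  have "lcong 1 (cofactor (qvar ^ 2 * w)) (cofactor (qvar ^ 2 * 1))"
    "lcong 1 (cofactor (qvar ^ 2 * z)) (cofactor (qvar ^ 2 * 1))"
    by (intro lcong_cofactor lcong_mult_left w_cong_1 z_cong_1; simp)+
  \<comment> \<open>All perturbations become 1, so \<open>1 + t + t^2\<close> contributes 3 and the
    total coefficient of \<open>C ^ 2\<close> is 4.\<close>
  then have "lcong 1 K (C ^ 2 + 1 * 1 * (1 + 1 + 1 ^ 2) * (C * C))"
    unfolding K_def using C_int
    by (intro lcong_add lcong_mult lcong_power lcong_refl t_cong_1 w_cong_1 integral_mult integral_add
        integral_power) (simp_all add: C_def)
  then have K_cong: "lcong 1 K (4 * C ^ 2)" by (simp add: power2_eq_square)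
  have b_cong: "lcong 1 b (a * (- 4))"
  proof -
    \<comment> \<open>Extending the fraction by \<open>qvar ^ N\<close> prepares the denominator for
      \<open>qpoch_q_cong\<close>, which supplies the minus sign.\<close>
    have "b = qvar ^ N * K / (P * (qvar ^ N * qpoch qvar p N))"
      by (simp add: b_def qvar_nonzero)
    also have "lcong 1 \<dots> (qvar ^ N * (4 * C ^ 2) / (P * - P))"
      by (intro lcong_divide lcong_mult_left K_cong qpoch_q_cong [folded P_def] integral_mult integral_power
          invertible_mult invertible_minus invertible_power invertible_qpoch_q P_inv invertible_qvar C_int
          invertible_integral[OF P_inv]) simp_all
    also have "qvar ^ N * (4 * C ^ 2) / (P * - P) = a * (- 4)"
      by (simp add: a_def power2_eq_square)
    finally show ?thesis .
  qed
  have "lcong 1 (a + b) (a + a * (- 4))" by (intro lcong_add lcong_refl b_cong)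
  also have "a + a * (- 4) = a * (- 3)" by (simp add: algebra_simps)
  also have "lcong 1 \<dots> (a * ?B)" by (intro lcong_mult_left a_int lcong_sym[OF rhs_factor_cong])
  finally have "lcong 3 ((1 - t) ^ 2 * (a + b)) ((1 - t) ^ 2 * (a * ?B))" by (rule lcong_3I)
  moreover have "qvar ^ N * qpoch (qvar ^ 2) p N ^ 2 / qpoch p p N ^ 2 = (1 - t) ^ 2 * a"
    unfolding a_def C_def P_def qpoch_cofactor[of "qvar ^ 2"] q2_p_h by (simp add: power_mult_distrib)
  moreover have "lcong 3 ?S ((1 - t) ^ 2 * a + (1 - t) ^ 2 * b)"
    using sum_cong unfolding calculation(2) qpoch_difference
    by (simp add: b_def K_def C_def P_def)
  ultimately show ?thesis
    by (metis (no_types, lifting) lcong_trans distrib_left mult.assoc)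
qed

end

theorem theorem1p2:
  fixes n :: nat
  assumes "n > 0" and "n mod 3 = 2"
  shows "qcong
    (\<Sum>k=0..(2*n-1) div 3.
        qpoch qvar (qvar^3) k ^ 3 / qpoch (qvar^3) (qvar^3) k ^ 3 * qvar ^ (3*k))
    (qvar ^ ((2*n-1) div 3) *
       qpoch (qvar^2) (qvar^3) ((2*n-1) div 3) ^ 2 / qpoch (qvar^3) (qvar^3) ((2*n-1) div 3) ^ 2 *
       (1 - qint (2*n) ^ 2 * (\<Sum>i=1..(2*n-1) div 3. qvar ^ (3*i-1) / qint (3*i-1) ^ 2)))
    (cyclotomic n ^ 3)"
proof -
  define h where "h = n div 3"
  have n: "n = 3 * h + 2" using assms(2) by (simp add: h_def) presburger
  \<comment> \<open>The division is exact: \<open>2 n - 1 = 3 (2 h + 1)\<close>.\<close>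
  have N: "(2 * n - 1) div 3 = 2 * h + 1" by (simp add: n)
  interpret two_mod_three h n "2 * h + 1" "qvar ^ 3" "qvar ^ (2 * n)" "inverse (qvar ^ (2 * n))" "qvar ^ n"
    by unfold_locales (simp_all add: n)
  show ?thesis
    using lcong_imp_qcong[OF main_cong] unfolding N by (simp add: atMost_atLeast0 power_mult)
qed

end
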